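(* Let $\mathbf{a}$ be a weak $m$-part composition of $n$ and let $t=(k,l)$ be a lattice point (with $0\le l\le m$) dominated by all cyclic shifts of $\mathbf{a}$. Then for every integer $c$, $$|\mathscr{G}_t(\mathbf{a})\cap\mathscr{C}_{c}| = m\binom{k+1}{c}\binom{l-1}{c-1}-n\binom{k}{c-1}\binom{l}{c}.$$
   Context: Lattice paths use unit steps $(0,1)$ (up) and $(1,0)$ (right). $\mathbf{a}=(a_0,\ldots,a_{m-1})$ is a tuple of nonnegative integers summing to $n$; indices read mod $m$. Let $f_{\mathbf{a}}(y)=a_r(y-r)+\sum_{j=0}^{r-1}a_j$ for $y\in[r,r+1]$, $0\le r<m$. A lattice point $(x,y)$ with $0\le y\le m$ is dominated by $\mathbf{a}$ if $x\ge f_{\mathbf{a}}(y)$; a path is dominated if all its lattice points are. Cyclic shifts: $\mathbf{a}^{j}=(a_{-j},\ldots,a_{-j+m-1})$. An LPBP is a pair $(P,(\mathbf{a},j))$ with $P$ a lattice path from the origin and $0\le j<m$; it is good if $P$ is dominated by $\mathbf{a}^j$. $\mathscr{G}_t(\mathbf{a})$ is the set of good LPBPs whose path ends at $t$. A right-up corner of a path is a point where a right step is immediately followed by an up step; in addition, an initial up step of the path counts as one (virtual) right-up corner. $\mathscr{C}_{c}$ is the set of LPBPs whose path has exactly $c$ right-up corners (real or virtual).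
   Formalization: Binomials are 0 unless 0 ≤ lower ≤ upper, except that C(-1,-1) is taken to be 1; this only matters at l = 0, c = 0, where the usual value 0 would give 0 instead of the true count m. Also C(-1,0) = 0, needed at l = 0, c = 1. *)

theory Defs
  imports Complex_Main
begin

subsection \<open>Lattice paths\<close>

datatype step = Up | Right

type_synonym path = "step list"

definition endpoint :: "path \<Rightarrow> int \<times> int" where
  "endpoint P = (int (count_list P Right), int (count_list P Up))"

text \<open>The paths start at the origin; both extremities of a path belong to it.\<close>

definition path_points :: "path \<Rightarrow> (int \<times> int) set" where
  "path_points P = {endpoint (take i P) | i. i \<le> length P}"

text \<open>A path visits each of its points only once, so a right-up corner is identified with the
  index of the right step that enters it. The second summand is the virtual corner.\<close>

definition num_corners :: "path \<Rightarrow> nat" where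
  "num_corners P =
     card {i. Suc i < length P \<and> P ! i = Right \<and> P ! Suc i = Up} +
     (if P \<noteq> [] \<and> hd P = Up then 1 else 0)"

subsection \<open>Weak compositions and the boundaries they define\<close>

definition weak_composition :: "nat \<Rightarrow> nat \<Rightarrow> nat list \<Rightarrow> bool" where
  "weak_composition m n a \<longleftrightarrow> length a = m \<and> sum_list a = n"

definition cyclic_shift :: "nat list \<Rightarrow> nat \<Rightarrow> nat list" where
  "cyclic_shift a j = map (\<lambda>i. a ! nat ((int i - int j) mod int (length a))) [0..<length a]"

text \<open>The boundary is piecewise linear on \<open>[0, m]\<close>, where \<open>m = length a\<close>, and only its values
  there are meaningful. The minimum puts \<open>y = m\<close> into the last piece; \<open>boundary_eq\<close> below shows
  that the pieces agree at their common ends.\<close>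

definition boundary :: "nat list \<Rightarrow> real \<Rightarrow> real" where
  "boundary a y = (let r = min (nat \<lfloor>y\<rfloor>) (length a - 1)
     in real (a ! r) * (y - real r) + (\<Sum>j<r. real (a ! j)))"

lemma boundary_eq:
  assumes "r < length a" "real r \<le> y" "y \<le> real r + 1"
  shows "boundary a y = real (a ! r) * (y - real r) + (\<Sum>j<r. real (a ! j))"
proof (cases "y = real r + 1 \<and> Suc r < length a")
  case True
  then have "nat \<lfloor>y\<rfloor> = Suc r" by linarith
  moreover have "Suc r \<le> length a - 1" using True by linarith
  ultimately have "min (nat \<lfloor>y\<rfloor>) (length a - 1) = Suc r" by linarith
  with True show ?thesis by (simp add: boundary_def)
next
  case False
  have "min (nat \<lfloor>y\<rfloor>) (length a - 1) = r"
  proof (cases "y = real r + 1")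
    case True
    then have "nat \<lfloor>y\<rfloor> = Suc r" by linarith
    moreover have "length a - 1 = r" using True \<open>\<not> (y = real r + 1 \<and> Suc r < length a)\<close> assms by linarith
    ultimately show ?thesis by linarith
  next
    case False
    then have "nat \<lfloor>y\<rfloor> = r" using assms by linarith
    moreover have "r \<le> length a - 1" using assms by linarith
    ultimately show ?thesis by linarith
  qed
  then show ?thesis by (simp add: boundary_def)
qed

definition dominated :: "nat list \<Rightarrow> int \<times> int \<Rightarrow> bool" where
  "dominated a p \<longleftrightarrow> (case p of (x, y) \<Rightarrow>
     0 \<le> y \<and> y \<le> int (length a) \<and> real_of_int x \<ge> boundary a (real_of_int y))"

definition path_dominated :: "nat list \<Rightarrow> path \<Rightarrow> bool" where
  "path_dominated a P \<longleftrightarrow> (\<forall>p \<in> path_points P. dominated a p)"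

subsection \<open>Lattice path boundary pairs\<close>

type_synonym lpbp = "path \<times> (nat list \<times> nat)"

definition LPBPs :: "lpbp set" where
  "LPBPs = {(P, (a, j)) | P a j. j < length a}"

definition good :: "lpbp \<Rightarrow> bool" where
  "good L \<longleftrightarrow> (case L of (P, (a, j)) \<Rightarrow> path_dominated (cyclic_shift a j) P)"

definition good_LPBPs :: "int \<times> int \<Rightarrow> nat list \<Rightarrow> lpbp set" where
  "good_LPBPs t a = {L \<in> LPBPs. good L \<and> fst (snd L) = a \<and> endpoint (fst L) = t}"

definition corner_LPBPs :: "int \<Rightarrow> lpbp set" where
  "corner_LPBPs c = {L \<in> LPBPs. int (num_corners (fst L)) = c}"

subsection \<open>Binomial coefficients with integer arguments\<close>

text \<open>The binomial coefficient vanishes outside \<open>0 \<le> b \<le> a\<close>, with one exception.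
  The binomial coefficient of \<open>l - 1\<close> over \<open>c - 1\<close> counts the compositions of \<open>l\<close> into \<open>c\<close>
  positive parts, and the empty composition of 0 requires the value 1 at \<open>(-1, -1)\<close>.\<close>

definition binom :: "int \<Rightarrow> int \<Rightarrow> int" where
  "binom a b =
     (if a = -1 \<and> b = -1 then 1
      else if 0 \<le> b \<and> b \<le> a then int (nat a choose nat b)
      else 0)"

end

theory Submission
  imports Defs
begin

text \<open>The pairs \<open>(P, j)\<close> with \<open>c\<close> corners are \<open>m\<close> times the paths, so the bad ones have to be counted.
  Split a bad path as \<open>P = u @ Up # v\<close> at the first up step that leaves the dominated region; this
  step traverses the part \<open>a ! p\<close> with \<open>p = #Up u - j\<close> modulo \<open>m\<close>, and the horizontal distance \<open>d\<close>
  from the boundary to the end of \<open>u\<close> satisfies \<open>0 \<le> d < a ! p\<close>. Put \<open>Q = rev u @ Right # rev v\<close>.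
  The split is recovered from \<open>(Q, p, d)\<close>: read backwards from the crossing, the boundary is the one
  given by the parts preceding \<open>p\<close>, and the inserted right step is the first one by which \<open>Q\<close>
  overshoots it at distance \<open>d\<close>. Since the end point is dominated by all cyclic shifts, every \<open>Q\<close>
  from the origin to \<open>(k + 1, l - 1)\<close> overshoots, whereas \<open>(p, d)\<close> takes \<open>n\<close> values. The number of
  corners of \<open>P\<close>, which is its number of maximal runs of up steps, becomes the number of maximal
  runs of right steps of \<open>Q\<close>.\<close>

section \<open>Corners as pairs of adjacent steps\<close>

fun adj :: "'a \<Rightarrow> 'a \<Rightarrow> 'a list \<Rightarrow> nat" where
  "adj x y (u # v # w) = (if u = x \<and> v = y then 1 else 0) + adj x y (v # w)"
| "adj x y _ = 0"

lemma adj_append: "adj x y (u @ z # v) = adj x y (u @ [z]) + adj x y (z # v)"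
proof (induction u)
  case (Cons s u)
  then show ?case by (cases u) auto
qed simp

lemma adj_rev: "adj x y (rev w) = adj y x w"
proof (induction w)
  case (Cons s w)
  then show ?case
    using adj_append[of x y "rev (tl w)" "hd w" "[s]"] by (cases w) auto
qed simp

text \<open>A right step put in front of the path turns the virtual corner into a real one.\<close>

lemma num_corners_eq_adj: "num_corners P = adj Right Up (Right # P)"
proof -
  have "card {i. Suc i < length P \<and> P ! i = x \<and> P ! Suc i = y} = adj x y P" for x y
  proof (induction x y P rule: adj.induct)
    case (1 x y u v w)
    let ?I = "\<lambda>w. {i. Suc i < length w \<and> w ! i = x \<and> w ! Suc i = y}"
    have fin: "finite (?I (v # w))"
      by (rule finite_subset[of _ "{..<length (v # w)}"]) auto
    have split: "?I (u # v # w) = Suc ` ?I (v # w) \<union> (if u = x \<and> v = y then {0} else {})"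
    proof (intro set_eqI)
      fix i show "i \<in> ?I (u # v # w) \<longleftrightarrow>
        i \<in> Suc ` ?I (v # w) \<union> (if u = x \<and> v = y then {0} else {})"
        by (cases i) (auto simp: image_iff)
    qed
    have "card (?I (u # v # w)) = card (Suc ` ?I (v # w)) + (if u = x \<and> v = y then 1 else 0)"
      unfolding split by (subst card_Un_disjoint) (use fin in auto)
    then show ?case
      using 1 by (simp add: card_image)
  qed auto
  then show ?thesis
    unfolding num_corners_def by (cases P) auto
qed

text \<open>Cut both words at the middle letter. The first pieces are reversals of each other; for
  the second ones, neither a \<open>y\<close> before \<open>v\<close> nor an \<open>x\<close> behind
  \<open>v\<close> adds a pair.\<close>

lemma adj_exchange:
  assumes "x \<noteq> y"
  shows "adj x y (x # u @ y # v) = adj y x (y # rev u @ x # rev v)"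
proof -
  have 1: "adj x y (y # v) = adj x y v"
    using assms by (cases v) auto
  have 2: "adj x y (v @ [x]) = adj x y v"
  proof (induction v)
    case (Cons s v)
    then show ?case using assms by (cases v) auto
  qed simp
  have "adj x y (x # u @ y # v) = adj x y (x # u @ [y]) + adj x y v"
    using adj_append[of x y "x # u" y v] 1 by simp
  moreover have "adj y x (y # rev u @ x # rev v)
      = adj y x (rev (x # u @ [y])) + adj y x (rev (v @ [x]))"
    using adj_append[of y x "y # rev u" x "rev v"] by simp
  ultimately show ?thesis
    by (simp only: adj_rev 2)
qed

section \<open>Words with given numbers of letters and of adjacent pairs\<close>

text \<open>\<open>z\<close> stands for a letter before the word; with \<open>z = x\<close> an
  initial \<open>y\<close> counts as a pair.\<close>

definition words :: "step \<Rightarrow> step \<Rightarrow> step \<Rightarrow> nat \<Rightarrow> nat \<Rightarrow> nat \<Rightarrow> path set" where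
  "words x y z k l c = {w. count_list w x = k \<and> count_list w y = l \<and> adj x y (z # w) = c}"

lemma length_eq_count_lists:
  fixes w :: path
  assumes "x \<noteq> y"
  shows "length w = count_list w x + count_list w y"
proof (induction w)
  case (Cons s w)
  moreover have "s = x \<or> s = y" using assms by (metis step.exhaust)
  ultimately show ?case using assms by auto
qed simp

lemma finite_step: "finite (UNIV :: step set)"
proof -
  have "UNIV = {Up, Right}" using step.exhaust by auto
  then show ?thesis by (metis finite.emptyI finite.insertI)
qed

lemma finite_words:
  assumes "x \<noteq> y"
  shows "finite (words x y z k l c)"
proof (rule finite_subset)
  show "words x y z k l c \<subseteq> {w. set w \<subseteq> UNIV \<and> length w = k + l}"
    by (auto simp: words_def length_eq_count_lists[OF assms])
  show "finite {w :: path. set w \<subseteq> UNIV \<and> length w = k + l}"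
    by (rule finite_lists_length_eq[OF finite_step])
qed

text \<open>The first letter takes over the role of \<open>z\<close>; it completes a pair only if it
  is \<open>y\<close> and \<open>z = x\<close>.\<close>

lemma words_split:
  assumes "x \<noteq> y" "0 < k + l"
  shows "words x y z k l c =
    (if k = 0 then {} else (#) x ` words x y x (k - 1) l c) \<union>
    (if l = 0 \<or> (z = x \<and> c = 0) then {}
     else (#) y ` words x y y k (l - 1) (if z = x then c - 1 else c))" (is "?L = ?R")
proof (intro set_eqI iffI)
  fix w assume w: "w \<in> ?L"
  then obtain s u where "w = s # u"
    using assms by (cases w) (auto simp: words_def)
  moreover have "s = x \<or> s = y" using assms by (metis step.exhaust)
  ultimately show "w \<in> ?R" using w assms by (auto simp: words_def)
qed (use assms in \<open>auto simp: words_def split: if_splits\<close>)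

lemma card_words_rec:
  assumes "x \<noteq> y" "0 < k + l"
  shows "card (words x y z k l c) =
    (if k = 0 then 0 else card (words x y x (k - 1) l c)) +
    (if l = 0 \<or> (z = x \<and> c = 0) then 0
     else card (words x y y k (l - 1) (if z = x then c - 1 else c)))"
  unfolding words_split[OF assms]
  by (subst card_Un_disjoint) (use assms in \<open>auto simp: card_image finite_words\<close>)

text \<open>A word counted in the first equation is given by the \<open>c\<close> places among the \<open>k + 1\<close> gaps left
  by the letters \<open>x\<close> that hold letters \<open>y\<close>, and a composition of \<open>l\<close> into \<open>c\<close> positive parts. In the
  second one the part in the initial gap may also vanish and does not count towards \<open>c\<close>.\<close>

lemma card_words:
  assumes "x \<noteq> y"
  shows "card (words x y x k l c) =
      (case (l, c) of (0, _) \<Rightarrow> of_bool (c = 0) | (Suc l', 0) \<Rightarrow> 0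
       | (Suc l', Suc c') \<Rightarrow> (Suc k choose c) * (l' choose c'))" (is ?A)
    and "card (words x y y k l c) = (k choose c) * (l choose c)" (is ?B)
proof -
  have "?A \<and> ?B"
  proof (induction "k + l" arbitrary: k l c)
    case 0
    have "w \<in> words x y z 0 0 c \<longleftrightarrow> w = [] \<and> c = 0" for w z
      using length_eq_count_lists[OF assms, of w] by (cases w) (auto simp: words_def)
    then have "words x y z 0 0 c = (if c = 0 then {[]} else {})" for z
      by auto
    then show ?case using 0 by (cases c) auto
  next
    case (Suc s)
    then have pos: "0 < k + l" by linarith
    have IH: "k' + l' = s \<Longrightarrow> card (words x y x k' l' c) =
      (case (l', c) of (0, _) \<Rightarrow> of_bool (c = 0) | (Suc l', 0) \<Rightarrow> 0
       | (Suc l', Suc c') \<Rightarrow> (Suc k' choose c) * (l' choose c'))"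
      "k' + l' = s \<Longrightarrow> card (words x y y k' l' c) = (k' choose c) * (l' choose c)" for k' l' c
      using Suc.hyps(1) by blast+
    \<comment> \<open>Pascal's rule, in \<open>k\<close> for the first count and in \<open>l\<close>
      for the second.\<close>
    show ?case
      unfolding card_words_rec[OF assms pos] using assms Suc.hyps(2)
      by (cases k; cases l; cases c) (simp_all add: IH algebra_simps)
  qed
  then show ?A ?B by auto
qed

section \<open>First crossings\<close>

text \<open>The cut is at the end of the shortest bad prefix. Badness need not persist: a path may
  return to the dominated region.\<close>

lemma first_crossing_exists:
  assumes "\<not> bad []" "bad w"
  obtains u x v where "w = u @ x # v" "bad (u @ [x])" "\<And>X Y. u = X @ Y \<Longrightarrow> \<not> bad X"
proof -
  define i where "i = (LEAST i. bad (take i w))"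
  have "bad (take (length w) w)" using assms by simp
  then have i: "bad (take i w)" "i \<le> length w"
    unfolding i_def by (rule LeastI, rule Least_le)
  have min: "\<not> bad (take i' w)" if "i' < i" for i'
    using that not_less_Least unfolding i_def by blast
  obtain i' where i': "i = Suc i'" using assms(1) i(1) by (cases i) auto
  show thesis
  proof (rule that)
    show "w = take i' w @ w ! i' # drop i w"
      using i(2) i' by (simp add: id_take_nth_drop)
    show "bad (take i' w @ [w ! i'])"
      using i i' by (simp add: take_Suc_conv_app_nth)
    show "\<not> bad X" if "take i' w = X @ Y" for X Y
    proof -
      have "X = take (length X) (take i' w)" using that by simp
      also have "\<dots> = take (min (length X) i') w" by simp
      finally show ?thesis using min[of "min (length X) i'"] i' by simp
    qed
  qed
qed

text \<open>If \<open>u\<close> and \<open>u'\<close> differed, the longer one would have the bad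
  prefix of the other split as a prefix.\<close>

lemma first_crossing_unique:
  assumes "u @ x # v = u' @ x' # v'" "bad (u @ [x])" "bad (u' @ [x'])"
    and "\<And>X Y. u = X @ Y \<Longrightarrow> \<not> bad X" "\<And>X Y. u' = X @ Y \<Longrightarrow> \<not> bad X"
  shows "u = u' \<and> x = x' \<and> v = v'"
proof -
  from assms(1) consider "u = u' \<and> x # v = x' # v'"
    | w where "u = u' @ w" "w @ x # v = x' # v'" "w \<noteq> []"
    | w where "u' = u @ w" "w @ x' # v' = x # v" "w \<noteq> []"
    unfolding append_eq_append_conv2 by (metis append.right_neutral append_Nil)
  then show ?thesis
  proof cases
    case 2
    then have "u = (u' @ [x']) @ tl w" by (cases w) auto
    then show ?thesis using assms by blast
  next
    case 3
    then have "u' = (u @ [x]) @ tl w" by (cases w) auto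
    then show ?thesis using assms by blast
  qed auto
qed

section \<open>Boundaries at integral heights\<close>

text \<open>For \<open>s = - j\<close> and \<open>h\<close> up to the length this is the shifted
  boundary at height \<open>h\<close>. An integer start also admits windows that end just before a
  given part.\<close>

definition window :: "nat list \<Rightarrow> int \<Rightarrow> nat \<Rightarrow> nat" where
  "window a s h = (\<Sum>i<h. a ! nat ((s + int i) mod int (length a)))"

lemma window_0 [simp]: "window a s 0 = 0"
  by (simp add: window_def)

lemma window_add: "window a s (g + h) = window a s g + window a (s + int g) h"
  by (induction h) (simp_all add: window_def add.assoc)

lemma window_cong:
  assumes "s mod int (length a) = s' mod int (length a)"
  shows "window a s h = window a s' h"
proof -
  have "(s + int i) mod int (length a) = (s' + int i) mod int (length a)" for i
    using assms by (metis mod_add_left_eq)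
  then show ?thesis by (simp add: window_def)
qed

lemma window_one: "p < length a \<Longrightarrow> s mod int (length a) = int p \<Longrightarrow> window a s 1 = a ! p"
  by (simp add: window_def)

lemma boundary_cyclic_shift:
  assumes "h \<le> length a" "0 < length a"
  shows "boundary (cyclic_shift a j) (real h) = real (window a (- int j) h)"
proof -
  have len: "length (cyclic_shift a j) = length a" by (simp add: cyclic_shift_def)
  have sum: "(\<Sum>i<h. real (cyclic_shift a j ! i)) = real (window a (- int j) h)"
    using assms by (simp add: window_def cyclic_shift_def)
  show ?thesis
  \<comment> \<open>The top height has no piece of its own; it is the upper end of the last
    piece.\<close>
  proof (cases "h = length a")
    case True
    then obtain r where r: "length a = Suc r" "h = Suc r" using assms(2) by (metis Suc_pred)
    show ?thesis
      using boundary_eq[of r "cyclic_shift a j" "real h"] sum len r by (simp add: add.commute)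
  next
    case False
    then show ?thesis
      using boundary_eq[of h "cyclic_shift a j" "real h"] sum assms len by simp
  qed
qed

definition crosses :: "nat list \<Rightarrow> int \<Rightarrow> path \<Rightarrow> bool" where
  "crosses a s P \<longleftrightarrow> count_list P Right < window a s (count_list P Up)"

text \<open>Lattice points have integral heights, so windows suffice; the bound on the up steps
  settles the height condition in \<open>dominated\<close>.\<close>

lemma path_dominated_cyclic_shift:
  assumes "0 < length a" "count_list P Up \<le> length a"
  shows "path_dominated (cyclic_shift a j) P \<longleftrightarrow> (\<forall>X Y. P = X @ Y \<longrightarrow> \<not> crosses a (- int j) X)"
proof -
  have dom: "dominated (cyclic_shift a j) (endpoint X) \<longleftrightarrow> \<not> crosses a (- int j) X"
    if "P = X @ Y" for X Y
  proof -
    have X: "count_list X Up \<le> length a" using assms(2) that by simp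
    have len: "length (cyclic_shift a j) = length a" by (simp add: cyclic_shift_def)
    show ?thesis
      using boundary_cyclic_shift[OF X assms(1), of j] X
      by (simp add: dominated_def endpoint_def crosses_def len not_less)
  qed
  have "path_points P = {endpoint X | X Y. P = X @ Y}"
  proof (intro equalityI subsetI)
    fix t assume "t \<in> path_points P"
    then obtain i where "t = endpoint (take i P)" by (auto simp: path_points_def)
    moreover have "P = take i P @ drop i P" by simp
    ultimately show "t \<in> {endpoint X | X Y. P = X @ Y}" by blast
  next
    fix t assume "t \<in> {endpoint X | X Y. P = X @ Y}"
    then obtain X Y where "t = endpoint X" "P = X @ Y" by blast
    then have "t = endpoint (take (length X) P)" "length X \<le> length P" by auto
    then show "t \<in> path_points P" unfolding path_points_def by blast
  qed
  then have "path_dominated (cyclic_shift a j) P \<longleftrightarrow>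
      (\<forall>X Y. P = X @ Y \<longrightarrow> dominated (cyclic_shift a j) (endpoint X))"
    by (simp only: path_dominated_def) blast
  then show ?thesis
    using dom by metis
qed

section \<open>Splitting bad pairs at the first crossing\<close>

text \<open>\<open>Q\<close> is read backwards from a point at distance \<open>d\<close> to the
  right of the boundary, so the window consists of the parts just preceding
  \<open>p\<close>.\<close>

definition overshoots :: "nat list \<Rightarrow> nat \<Rightarrow> nat \<Rightarrow> path \<Rightarrow> bool" where
  "overshoots a p d Q \<longleftrightarrow>
     d + window a (int p - int (count_list Q Up)) (count_list Q Up) < count_list Q Right"

lemma count_list_rev: "count_list (rev w) x = count_list w x"
  by (induction w) auto

text \<open>The window over \<open>X @ Y\<close> is the sum of those over \<open>X\<close> and
  \<open>Y\<close>; subtracting the share of \<open>Y\<close> compares \<open>X\<close> with the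
  boundary.\<close>

lemma crosses_iff_overshoots:
  assumes "(s + int (count_list (X @ Y) Up)) mod int (length a) = int p mod int (length a)"
    and "count_list (X @ Y) Right = d + window a s (count_list (X @ Y) Up)"
  shows "crosses a s X \<longleftrightarrow> overshoots a p d (rev Y)"
proof -
  have "(s + int (count_list X Up)) mod int (length a) =
      (int p - int (count_list Y Up)) mod int (length a)"
    using mod_diff_cong[OF assms(1) refl, of "int (count_list Y Up)"] by simp
  then show ?thesis
    using assms(2) window_add[of a s "count_list X Up" "count_list Y Up"]
      window_cong[of "s + int (count_list X Up)" a "int p - int (count_list Y Up)"]
    by (auto simp: crosses_def overshoots_def count_list_rev)
qed

definition bad_pairs :: "nat list \<Rightarrow> nat \<Rightarrow> nat \<Rightarrow> nat \<Rightarrow> (path \<times> nat) set" where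
  "bad_pairs a k l c = {(P, j). j < length a \<and> P \<in> words Right Up Right k l c \<and>
     (\<exists>X Y. P = X @ Y \<and> crosses a (- int j) X)}"

text \<open>The set between the two bijections. The shift is left out, being determined by
  \<open>p\<close> and \<open>u\<close>; prefixes of \<open>u\<close> are tested through the
  complementary suffixes.\<close>

definition split_pairs :: "nat list \<Rightarrow> nat \<Rightarrow> nat \<Rightarrow> nat \<Rightarrow> (path \<times> path \<times> nat \<times> nat) set" where
  "split_pairs a k l c = {(u, v, p, d). p < length a \<and> d < a ! p \<and>
     u @ Up # v \<in> words Right Up Right k l c \<and>
     count_list u Right = d + window a (int p - int (count_list u Up)) (count_list u Up) \<and>
     (\<forall>X Y. u = X @ Y \<longrightarrow> \<not> overshoots a p d (rev Y))}"

text \<open>The shift \<open>j\<close>, solved from \<open>p = #Up u - j\<close> modulo the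
  length.\<close>

definition first_index :: "nat list \<Rightarrow> nat \<Rightarrow> path \<Rightarrow> nat" where
  "first_index a p u = nat ((int (count_list u Up) - int p) mod int (length a))"

lemma first_index_mod:
  assumes "0 < length a"
  shows "(- int (first_index a p u) + int (count_list u Up)) mod int (length a) =
    int p mod int (length a)"
proof -
  let ?h = "int (count_list u Up)" and ?m = "int (length a)"
  have "(- ((?h - int p) mod ?m) + ?h) mod ?m = (?h - (?h - int p) mod ?m) mod ?m"
    by (simp add: algebra_simps)
  also have "\<dots> = (?h - (?h - int p)) mod ?m"
    by (rule mod_diff_right_eq)
  finally show ?thesis
    using assms by (simp add: first_index_def)
qed

lemma first_index_less: "0 < length a \<Longrightarrow> first_index a p u < length a"
  by (simp add: first_index_def nat_less_iff)

text \<open>The up step after \<open>u\<close> raises the boundary by \<open>a ! p\<close>, which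
  exceeds the distance \<open>d\<close>.\<close>

lemma split_pairs_crossing:
  assumes "(u, v, p, d) \<in> split_pairs a k l c"
  shows "crosses a (- int (first_index a p u)) (u @ [Up])"
    and "u = X @ Y \<Longrightarrow> \<not> crosses a (- int (first_index a p u)) X"
    and "count_list u Right = d + window a (- int (first_index a p u)) (count_list u Up)"
proof -
  let ?s = "- int (first_index a p u)" and ?h = "count_list u Up"
  have p: "p < length a" "0 < length a" and d: "d < a ! p"
    using assms by (auto simp: split_pairs_def)
  have s: "(?s + int ?h) mod int (length a) = int p mod int (length a)"
    by (rule first_index_mod[OF p(2)])
  have "window a (int p - int ?h) ?h = window a ?s ?h"
  proof (rule window_cong)
    have "(?s + int ?h - int ?h) mod int (length a) = (int p - int ?h) mod int (length a)"
      using s by (metis mod_diff_left_eq)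
    then show "(int p - int ?h) mod int (length a) = ?s mod int (length a)" by simp
  qed
  then show R: "count_list u Right = d + window a ?s ?h"
    using assms by (simp add: split_pairs_def)
  have "window a ?s (?h + 1) = window a ?s ?h + a ! p"
    using window_add[of a ?s ?h 1] window_one[OF p(1), of "?s + int ?h"] s p by simp
  then show "crosses a ?s (u @ [Up])"
    using R d by (simp add: crosses_def)
  show "\<not> crosses a ?s X" if "u = X @ Y"
    using crosses_iff_overshoots[of ?s X Y a p d] s R assms that
    by (auto simp: split_pairs_def)
qed

text \<open>Path and shift determine the first crossing, hence \<open>u\<close> and
  \<open>v\<close>; the height of \<open>u\<close> then gives \<open>p\<close>, and its distance
  from the boundary gives \<open>d\<close>.\<close>

lemma bij_betw_bad_pairs:
  assumes "0 < length a"
  shows "bij_betw (\<lambda>(u, v, p, d). (u @ Up # v, first_index a p u))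
    (split_pairs a k l c) (bad_pairs a k l c)"
proof (rule bij_betw_imageI)
  show "inj_on (\<lambda>(u, v, p, d). (u @ Up # v, first_index a p u)) (split_pairs a k l c)"
  proof (rule inj_onI, clarsimp)
    fix u v p d u' v' p' d'
    assume in_split: "(u, v, p, d) \<in> split_pairs a k l c" "(u', v', p', d') \<in> split_pairs a k l c"
      and eq: "u @ Up # v = u' @ Up # v'" "first_index a p u = first_index a p' u'"
    have uv: "u = u' \<and> Up = Up \<and> v = v'"
    proof (rule first_crossing_unique[OF eq(1)])
      show "crosses a (- int (first_index a p u)) (u @ [Up])"
        by (rule split_pairs_crossing(1)[OF in_split(1)])
      show "crosses a (- int (first_index a p u)) (u' @ [Up])"
        unfolding eq(2) by (rule split_pairs_crossing(1)[OF in_split(2)])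
      show "\<not> crosses a (- int (first_index a p u)) X" if "u = X @ Y" for X Y
        using that by (rule split_pairs_crossing(2)[OF in_split(1)])
      show "\<not> crosses a (- int (first_index a p u)) X" if "u' = X @ Y" for X Y
        unfolding eq(2) using that by (rule split_pairs_crossing(2)[OF in_split(2)])
    qed
    have "p < length a" "p' < length a"
      using in_split by (auto simp: split_pairs_def)
    then have "p = p'"
      using first_index_mod[OF assms, of p u] first_index_mod[OF assms, of p' u']
      unfolding eq(2) unfolding uv[THEN conjunct1] by simp
    moreover have "d = d'"
      using split_pairs_crossing(3)[OF in_split(1)] split_pairs_crossing(3)[OF in_split(2)]
      unfolding eq(2) unfolding uv[THEN conjunct1] by linarith
    ultimately show "u = u' \<and> v = v' \<and> p = p' \<and> d = d'" using uv by blast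
  qed
  show "(\<lambda>(u, v, p, d). (u @ Up # v, first_index a p u)) ` split_pairs a k l c = bad_pairs a k l c"
  proof (intro equalityI subsetI)
    fix L assume "L \<in> (\<lambda>(u, v, p, d). (u @ Up # v, first_index a p u)) ` split_pairs a k l c"
    then obtain u v p d where L: "L = (u @ Up # v, first_index a p u)"
      and in_split: "(u, v, p, d) \<in> split_pairs a k l c" by auto
    have "u @ Up # v = (u @ [Up]) @ v" by simp
    then have "\<exists>X Y. u @ Up # v = X @ Y \<and> crosses a (- int (first_index a p u)) X"
      using split_pairs_crossing(1)[OF in_split] by blast
    then show "L \<in> bad_pairs a k l c"
      using in_split first_index_less[OF assms] by (auto simp: L bad_pairs_def split_pairs_def)
  next
    fix L assume "L \<in> bad_pairs a k l c"
    then obtain P j X Y where L: "L = (P, j)" and j: "j < length a"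
      and P: "P \<in> words Right Up Right k l c" "P = X @ Y" "crosses a (- int j) X"
      by (auto simp: bad_pairs_def)
    obtain u x v where X: "X = u @ x # v" "crosses a (- int j) (u @ [x])"
      and u: "\<And>X Y. u = X @ Y \<Longrightarrow> \<not> crosses a (- int j) X"
      by (rule first_crossing_exists[of "crosses a (- int j)" X]) (use P(3) in \<open>simp_all add: crosses_def\<close>)
    have not_u: "\<not> crosses a (- int j) u" using u[of u "[]"] by simp
    \<comment> \<open>A right step cannot leave the dominated region.\<close>
    have x: "x = Up"
      using not_u X(2) by (cases x) (auto simp: crosses_def)
    define s h where "s = - int j" and "h = count_list u Up"
    \<comment> \<open>The natural subtraction in \<open>d\<close> is exact because \<open>u\<close>
      does not cross.\<close>
    define p d where "p = nat ((s + int h) mod int (length a))"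
      and "d = count_list u Right - window a s h"
    have p: "p < length a" "int p = (s + int h) mod int (length a)"
      using assms by (auto simp: p_def nat_less_iff)
    have R: "count_list u Right = d + window a s h"
      using not_u by (simp add: crosses_def d_def s_def h_def)
    have "window a s (h + 1) = window a s h + a ! p"
      using window_add[of a s h 1] window_one[OF p(1), of "s + int h"] p(2) by simp
    then have d: "d < a ! p"
      using X(2) x R by (simp add: crosses_def s_def h_def)
    have "(int p - int h) mod int (length a) = s mod int (length a)"
      unfolding p(2) by (simp add: mod_diff_left_eq)
    then have "window a (int p - int h) h = window a s h"
      by (rule window_cong)
    moreover have "\<not> overshoots a p d (rev Y)" if "u = X @ Y" for X Y
      using crosses_iff_overshoots[of s X Y a p d] u[OF that] p(2) R that
      by (simp add: s_def h_def)
    moreover have P': "P = u @ Up # (v @ Y)" using P X x by simp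
    ultimately have in_split: "(u, v @ Y, p, d) \<in> split_pairs a k l c"
      using p d R P by (simp add: split_pairs_def h_def)
    have "first_index a p u = nat ((int h - (s + int h)) mod int (length a))"
      unfolding first_index_def p(2) h_def by (simp add: mod_diff_right_eq)
    then have "first_index a p u = j" using j by (simp add: s_def)
    then show "L \<in> (\<lambda>(u, v, p, d). (u @ Up # v, first_index a p u)) ` split_pairs a k l c"
      unfolding L P' by (intro image_eqI[OF _ in_split]) simp
  qed
qed

section \<open>Exchanging the crossing up step for a right step\<close>

text \<open>\<open>l \<noteq> 0\<close> keeps the truncated \<open>l - 1\<close> from admitting
  \<open>l = 0\<close> on the right.\<close>

lemma exchange_in_words:
  "u @ Up # v \<in> words Right Up Right k l c \<longleftrightarrow>
   l \<noteq> 0 \<and> rev u @ Right # rev v \<in> words Up Right Up (l - 1) (Suc k) c"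
  using adj_exchange[of Right Up u v] by (auto simp: words_def count_list_rev)

text \<open>The inverse cuts \<open>Q\<close> at its first overshoot, whose existence follows from
  the bound on the windows of length \<open>l\<close>.\<close>

lemma bij_betw_words:
  assumes "0 < length a" "0 < l" "\<And>j. j < length a \<Longrightarrow> window a (- int j) l \<le> k"
  shows "bij_betw (\<lambda>(u, v, p, d). (rev u @ Right # rev v, p, d)) (split_pairs a k l c)
    (words Up Right Up (l - 1) (Suc k) c \<times> (SIGMA p:{..<length a}. {..<a ! p}))"
    (is "bij_betw ?f _ ?W")
proof (rule bij_betw_imageI)
  have after: "overshoots a p d (rev u @ [Right])"
    and before: "rev u = X @ Y \<Longrightarrow> \<not> overshoots a p d X"
    if "(u, v, p, d) \<in> split_pairs a k l c" for u v p d X Y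
  proof -
    show "overshoots a p d (rev u @ [Right])"
      using that by (simp add: split_pairs_def overshoots_def count_list_rev)
    assume "rev u = X @ Y"
    then have "u = rev Y @ rev X" by (metis rev_append rev_rev_ident)
    moreover have "\<forall>X Y. u = X @ Y \<longrightarrow> \<not> overshoots a p d (rev Y)"
      using that by (simp add: split_pairs_def)
    ultimately show "\<not> overshoots a p d X"
      by (metis rev_rev_ident)
  qed
  show "inj_on ?f (split_pairs a k l c)"
  proof (rule inj_onI, clarsimp)
    fix u v p d u' v'
    assume in_split: "(u, v, p, d) \<in> split_pairs a k l c" "(u', v', p, d) \<in> split_pairs a k l c"
      and eq: "rev u @ Right # rev v = rev u' @ Right # rev v'"
    have "rev u = rev u' \<and> Right = Right \<and> rev v = rev v'"
      by (rule first_crossing_unique[OF eq, of "overshoots a p d"])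
        (use after before in_split in blast)+
    then show "u = u' \<and> v = v'" by simp
  qed
  show "?f ` split_pairs a k l c = ?W"
  proof (intro equalityI subsetI)
    fix L assume "L \<in> ?f ` split_pairs a k l c"
    then show "L \<in> ?W"
      by (auto simp: split_pairs_def exchange_in_words)
  next
    fix L assume "L \<in> ?W"
    then obtain Q p d where L: "L = (Q, p, d)" and p: "p < length a" and d: "d < a ! p"
      and Q: "Q \<in> words Up Right Up (l - 1) (Suc k) c" by auto
    \<comment> \<open>For this shift the window of length \<open>l\<close> from \<open>- j\<close>
      has \<open>p\<close> as its last part.\<close>
    define j where "j = nat ((int (l - 1) - int p) mod int (length a))"
    have j: "j < length a" "int j = (int (l - 1) - int p) mod int (length a)"
      using assms(1) by (auto simp: j_def nat_less_iff)
    have "- int j mod int (length a) = (int p - int (l - 1)) mod int (length a)"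
      unfolding j(2) by (simp add: mod_minus_eq)
    then have "window a (int p - int (l - 1)) l \<le> k"
      using assms(3)[OF j(1)] window_cong by metis
    moreover have "window a (int p - int (l - 1)) l =
        window a (int p - int (l - 1)) (l - 1) + a ! p"
      using window_add[of a "int p - int (l - 1)" "l - 1" 1] window_one[OF p, of "int p"] assms(2) p
      by simp
    \<comment> \<open>By \<open>d < a ! p\<close>, the threshold is below the full window, hence
      below the \<open>k + 1\<close> right steps of \<open>Q\<close>.\<close>
    ultimately have "overshoots a p d Q"
      using Q d by (simp add: overshoots_def words_def)
    then obtain u x v where Q': "Q = u @ x # v" "overshoots a p d (u @ [x])"
      and u: "\<And>X Y. u = X @ Y \<Longrightarrow> \<not> overshoots a p d X"
      by (rule first_crossing_exists[of "overshoots a p d" Q, rotated]) (auto simp: overshoots_def)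
    have not_u: "\<not> overshoots a p d u" using u[of u "[]"] by simp
    \<comment> \<open>An up step only extends the window by one part at its front.\<close>
    have "\<not> overshoots a p d (u @ [Up])"
      using not_u window_add[of a "int p - int (Suc (count_list u Up))" 1 "count_list u Up"]
      by (simp add: overshoots_def)
    then have x: "x = Right" using Q'(2) by (cases x) auto
    \<comment> \<open>A single right step passes the threshold, so \<open>u\<close> attains it
      exactly.\<close>
    have "count_list u Right = d + window a (int p - int (count_list u Up)) (count_list u Up)"
      using not_u Q'(2) x by (simp add: overshoots_def)
    moreover have "\<not> overshoots a p d (rev Y)" if "rev u = X @ Y" for X Y
      using u[of "rev Y" "rev X"] that by (metis rev_append rev_rev_ident)
    moreover have "rev u @ Up # rev v \<in> words Right Up Right k l c"
      using Q Q'(1) x assms(2) by (simp add: exchange_in_words)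
    ultimately have "(rev u, rev v, p, d) \<in> split_pairs a k l c"
      using p d by (simp add: split_pairs_def count_list_rev)
    then show "L \<in> ?f ` split_pairs a k l c"
      unfolding L Q'(1) x by (rule image_eqI[rotated]) simp
  qed
qed

text \<open>\<open>Q\<close> is independent of \<open>(p, d)\<close>, and the pairs with
  \<open>d < a ! p\<close> number \<open>sum_list a\<close>.\<close>

lemma card_bad_pairs:
  assumes "0 < length a" "0 < l" "\<And>j. j < length a \<Longrightarrow> window a (- int j) l \<le> k"
  shows "card (bad_pairs a k l c) = sum_list a * card (words Up Right Up (l - 1) (Suc k) c)"
proof -
  have "card (bad_pairs a k l c) =
      card (words Up Right Up (l - 1) (Suc k) c \<times> (SIGMA p:{..<length a}. {..<a ! p}))"
    using bij_betw_same_card[OF bij_betw_bad_pairs[OF assms(1)]]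
      bij_betw_same_card[OF bij_betw_words[OF assms]] by metis
  also have "\<dots> = sum_list a * card (words Up Right Up (l - 1) (Suc k) c)"
    by (simp add: card_cartesian_product sum_list_sum_nth atLeast0LessThan)
  finally show ?thesis .
qed

lemma bad_pairs_zero: "bad_pairs a k 0 c = {}"
  by (auto simp: bad_pairs_def words_def crosses_def)

section \<open>Counting the good pairs\<close>

lemma good_corner_LPBPs:
  assumes "0 < length a" "l \<le> length a"
  shows "good_LPBPs (int k, int l) a \<inter> corner_LPBPs (int c) =
    (\<lambda>(P, j). (P, (a, j))) ` (words Right Up Right k l c \<times> {..<length a} - bad_pairs a k l c)"
  (is "?G = ?f ` ?D")
proof (intro set_eqI iffI)
  fix L assume "L \<in> ?G"
  then obtain P j where L: "L = (P, (a, j))" and j: "j < length a"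
    and dom: "path_dominated (cyclic_shift a j) P" and P: "P \<in> words Right Up Right k l c"
    by (auto simp: good_LPBPs_def corner_LPBPs_def LPBPs_def good_def endpoint_def words_def
        num_corners_eq_adj)
  have "(P, j) \<in> ?D"
    using dom P j assms path_dominated_cyclic_shift[of a P j]
    by (auto simp: bad_pairs_def words_def)
  then show "L \<in> ?f ` ?D" using L by force
next
  fix L assume "L \<in> ?f ` ?D"
  then show "L \<in> ?G"
    using assms path_dominated_cyclic_shift[of a]
    by (auto simp: good_LPBPs_def corner_LPBPs_def LPBPs_def good_def endpoint_def words_def
        num_corners_eq_adj bad_pairs_def)
qed

theorem theorem3:
  fixes a :: "nat list" and m n :: nat and k l c :: int
  assumes "m \<ge> 1"
    and "weak_composition m n a"
    and "0 \<le> l" and "l \<le> int m"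
    and "\<forall>j<m. dominated (cyclic_shift a j) (k, l)"
  shows "int (card (good_LPBPs (k, l) a \<inter> corner_LPBPs c)) =
    int m * binom (k + 1) c * binom (l - 1) (c - 1) - int n * binom k (c - 1) * binom l c"
proof -
  have a: "length a = m" "sum_list a = n" "0 < length a"
    using assms(1,2) by (auto simp: weak_composition_def)
  obtain L where L: "l = int L" using assms(3) nonneg_int_cases by blast
  have len: "L \<le> length a" using assms(4) L a by simp
  have window: "int (window a (- int j) L) \<le> k" if "j < m" for j
    using assms(5) that boundary_cyclic_shift[OF len a(3), of j] L by (auto simp: dominated_def)
  \<comment> \<open>Some shift exists as \<open>m \<ge> 1\<close>, and its window bounds
    \<open>k\<close> below by a natural number.\<close>
  then obtain K where K: "k = int K"
    using assms(1) by (metis less_eq_Suc_le One_nat_def nonneg_int_cases of_nat_0_le_iff order_trans)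
  show ?thesis
  proof (cases "c < 0")
    case True
    then show ?thesis by (simp add: corner_LPBPs_def binom_def K)
  next
    case False
    then obtain C where C: "c = int C" using nonneg_int_cases by (metis linorder_not_less)
    let ?W = "words Right Up Right K L C"
    have sub: "bad_pairs a K L C \<subseteq> ?W \<times> {..<m}"
      using a by (auto simp: bad_pairs_def)
    have fin: "finite (?W \<times> {..<m})" by (simp add: finite_words)
    have "card (good_LPBPs (k, l) a \<inter> corner_LPBPs c) = card (?W \<times> {..<m} - bad_pairs a K L C)"
      unfolding K L C good_corner_LPBPs[OF a(3) len] a(1)
      by (rule card_image) (auto simp: inj_on_def)
    also have "int \<dots> = int (card (?W \<times> {..<m})) - int (card (bad_pairs a K L C))"
      using card_Diff_subset[OF finite_subset[OF sub fin] sub] card_mono[OF fin sub] by simp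
    finally have card: "int (card (good_LPBPs (k, l) a \<inter> corner_LPBPs c)) =
        int m * int (card ?W) - int (card (bad_pairs a K L C))"
      by (simp add: card_cartesian_product)
    have binom_nat: "binom (int x) (int y) = int (x choose y)" for x y
      by (simp add: binom_def)
    have binom_neg: "binom (int x) (- 1) = 0" for x
      by (simp add: binom_def)
    show ?thesis
    proof (cases L)
      \<comment> \<open>For \<open>C = 0\<close> the exceptional value of \<open>binom\<close> at
        \<open>(-1, -1)\<close> is used.\<close>
      case 0
      then show ?thesis
        unfolding card using card_words(1)[of Right Up K 0 C] L C K
        by (auto simp: bad_pairs_zero binom_def)
    next
      case (Suc L')
      have bad: "card (bad_pairs a K L C) = n * card (words Up Right Up L' (Suc K) C)"
        using card_bad_pairs[of a L K C] window a K Suc by simp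
      have l: "l - 1 = int L'" "k + 1 = int (Suc K)" using L K Suc by auto
      show ?thesis
      proof (cases C)
        \<comment> \<open>Without corners both counts vanish: the paths have up steps, and the words
          \<open>Q\<close> have right steps.\<close>
        case 0
        then show ?thesis
          unfolding card bad l unfolding K L C Suc
          by (simp add: card_words binom_neg)
      next
        case (Suc C')
        then have "c - 1 = int C'" using C by simp
        \<comment> \<open>The same count serves both terms; for the bad pairs the two letters
          exchange roles.\<close>
        then show ?thesis
          unfolding card bad l unfolding K L C \<open>L = Suc L'\<close> Suc
          by (simp only: binom_nat) (simp add: card_words)
      qed
    qed
  qed
qed

end
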